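(* Let $k$ be an algebraically closed field of characteristic zero, $A=k[x,y]$, $\mathfrak m=(x,y)$. Let $M$ be an $A$-module of length $4$ supported at $\mathfrak m$ with $\dim_k M/\mathfrak m M=3$. Then either $M\cong k\oplus (A/\mathfrak m^2)^\ast$, or $M\cong k^2\oplus\mathscr O_Z$, where $k=A/\mathfrak m$ and $\mathscr O_Z=A/I$ is the structure sheaf of a length-$2$ subscheme $Z\subset\mathbb A^2$ supported at the origin.
   Context: $(A/\mathfrak m^2)^\ast=\operatorname{Hom}_k(A/\mathfrak m^2,k)$ with $A$-action $(a\cdot\varphi)(m)=\varphi(am)$. *)

theory Defs
  imports "HOL-Analysis.Analysis" "HOL-Computational_Algebra.Polynomial"
begin

text \<open>A finite-dimensional module over A = k[x,y] is modelled as a pair of commuting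
  k-linear operators (the actions of x and y) on a coordinate space 'k^'n, given by matrices.\<close>

definition algebraically_closed_field :: "'k::field itself \<Rightarrow> bool" where
  "algebraically_closed_field _ \<longleftrightarrow> (\<forall>p::'k poly. degree p > 0 \<longrightarrow> (\<exists>z. poly p z = 0))"

definition kxy_module :: "'k::field^'n^'n \<Rightarrow> 'k^'n^'n \<Rightarrow> bool" where
  "kxy_module X Y \<longleftrightarrow> X ** Y = Y ** X"

text \<open>Action of the monomial x^i y^j.\<close>
definition mono_act :: "'k::field^'n^'n \<Rightarrow> 'k^'n^'n \<Rightarrow> nat \<Rightarrow> nat \<Rightarrow> 'k^'n \<Rightarrow> 'k^'n" where
  "mono_act X Y i j v = ((\<lambda>u. X *v u) ^^ i) (((\<lambda>u. Y *v u) ^^ j) v)"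

text \<open>Supported at m = (x,y) (finite length): m^N M = 0 for some N.\<close>
definition supported_at_origin :: "'k::field^'n^'n \<Rightarrow> 'k^'n^'n \<Rightarrow> bool" where
  "supported_at_origin X Y \<longleftrightarrow> (\<exists>N. \<forall>i j v. i + j = N \<longrightarrow> mono_act X Y i j v = 0)"

text \<open>The submodule mM = xM + yM.\<close>
definition mM :: "'k::field^'n^'n \<Rightarrow> 'k^'n^'n \<Rightarrow> ('k^'n) set" where
  "mM X Y = vec.span (range (\<lambda>v. X *v v) \<union> range (\<lambda>v. Y *v v))"

text \<open>dim_k (M / mM).\<close>
definition top_dim :: "'k::field^'n^'n \<Rightarrow> 'k^'n^'n \<Rightarrow> nat" where
  "top_dim X Y = vec.dim (UNIV :: ('k^'n) set) - vec.dim (mM X Y)"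

text \<open>Isomorphism of k[x,y]-modules.\<close>
definition kxy_iso :: "'k::field^'n^'n \<Rightarrow> 'k^'n^'n \<Rightarrow> 'k^'m^'m \<Rightarrow> 'k^'m^'m \<Rightarrow> bool" where
  "kxy_iso X Y X' Y' \<longleftrightarrow> (\<exists>f :: 'k^'n \<Rightarrow> 'k^'m.
      Vector_Spaces.linear (*s) (*s) f \<and> bij f \<and>
      (\<forall>v. f (X *v v) = X' *v f v) \<and> (\<forall>v. f (Y *v v) = Y' *v f v))"

text \<open>Cyclic module (= A/I for an ideal I, namely I = Ann(v)).\<close>
definition cyclic_module :: "'k::field^'n^'n \<Rightarrow> 'k^'n^'n \<Rightarrow> bool" where
  "cyclic_module X Y \<longleftrightarrow> (\<exists>v. vec.span {mono_act X Y i j v | i j. True} = UNIV)"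

text \<open>Direct sum of modules (block-diagonal operators).\<close>
definition dsum :: "'k::field^'a^'a \<Rightarrow> 'k^'b^'b \<Rightarrow> 'k^('a + 'b)^('a + 'b)" where
  "dsum A B = (\<chi> i j. case (i, j) of (Inl a, Inl b) \<Rightarrow> A $ a $ b
                                   | (Inr a, Inr b) \<Rightarrow> B $ a $ b
                                   | _ \<Rightarrow> 0)"

text \<open>A/m^2 with k-basis (1, x, y) = (e1, e2, e3): x maps 1 to x, y maps 1 to y, all else to 0.\<close>
definition Am2_x :: "'k::field^3^3" where
  "Am2_x = (\<chi> i j. if i = 2 \<and> j = 1 then 1 else 0)"
definition Am2_y :: "'k::field^3^3" where
  "Am2_y = (\<chi> i j. if i = 3 \<and> j = 1 then 1 else 0)"

text \<open>Dual module Hom_k(N,k) with (a.phi)(m) = phi(a m): in dual coordinates the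
  operator of a is the transpose.\<close>
definition dual_op :: "'k::field^'n^'n \<Rightarrow> 'k^'n^'n" where
  "dual_op A = transpose A"

end

theory Submission
  imports Defs
begin

text \<open>Since dim M = 4 and dim M/mM = 3, mM is a line k w, so x and y act as v |-> a(v) w and
  v |-> b(v) w for linear forms a and b, and nilpotency forces a(w) = b(w) = 0. If a and b are
  linearly independent, take u_a, u_b dual to (a, b) and z in ker a and ker b outside k w: in the
  basis (z, w, u_a, u_b) the module is k + (A/m^2)^*. If a = s g and b = t g, take u with g(u) = 1
  and p, q in ker g independent modulo w: in the basis (p, q, u, w) the module is
  k^2 + A/(m^2, t x - s y).\<close>

lemma sum_Plus_UNIV:
  "sum f (UNIV :: ('a::finite + 'b::finite) set) = (\<Sum>a\<in>UNIV. f (Inl a)) + (\<Sum>b\<in>UNIV. f (Inr b))"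
  by (simp add: UNIV_Plus_UNIV[symmetric] sum.Plus comp_def del: UNIV_Plus_UNIV)

lemma matrix_of_columns_mult:
  fixes f :: "'m::finite \<Rightarrow> 'k::field^'n"
  shows "(\<chi> r c. f c $ r) *v v = (\<Sum>c\<in>UNIV. v $ c *s f c)"
  by (simp add: matrix_mult_sum column_def)

lemma scale_in_span_imp_zero:
  fixes u :: "'k::field^'n"
  assumes "c *s u \<in> vec.span S" and "u \<notin> vec.span S"
  shows "c = 0"
proof (rule ccontr)
  assume "c \<noteq> 0"
  have "inverse c *s (c *s u) \<in> vec.span S" using assms(1) by (rule vec.span_scale)
  with \<open>c \<noteq> 0\<close> assms(2) show False by simp
qed

lemma exists_not_in_span:
  fixes S :: "('k::field^'n) set"
  assumes "finite S" and "card S < CARD('n)"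
  obtains v where "v \<notin> vec.span S"
proof -
  have "\<not> UNIV \<subseteq> vec.span S"
    using vec.dim_le_card[OF _ assms(1), of UNIV] assms(2) by (auto simp: vec_dim_card card_cart_basis)
  then show ?thesis using that by blast
qed

subsection \<open>Linear forms on k^n\<close>

definition dot :: "'k::field^'n \<Rightarrow> 'k^'n \<Rightarrow> 'k" where
  "dot a v = (\<Sum>j\<in>UNIV. a $ j * v $ j)"

lemma dot_add [simp]: "dot a (x + y) = dot a x + dot a y"
  by (simp add: dot_def algebra_simps sum.distrib)

lemma dot_diff [simp]: "dot a (x - y) = dot a x - dot a y"
  by (simp add: dot_def algebra_simps sum_subtractf)

lemma dot_scale [simp]: "dot a (c *s x) = c * dot a x"
  by (simp add: dot_def algebra_simps sum_distrib_left)

lemma dot_scale_left [simp]: "dot (c *s a) x = c * dot a x"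
  by (simp add: dot_def algebra_simps sum_distrib_left)

lemma dot_zero [simp]: "dot a 0 = 0" "dot 0 x = 0"
  by (simp_all add: dot_def)

lemma dot_axis [simp]: "dot a (axis i 1) = a $ i"
  by (simp add: dot_def axis_def if_distrib cong: if_cong)

lemma exists_dot_eq_1:
  fixes g :: "'k::field^'n"
  assumes "g \<noteq> 0"
  obtains u where "dot g u = 1"
proof -
  obtain j where "g $ j \<noteq> 0" using assms by (metis vec_eq_iff zero_index)
  then have "dot g (inverse (g $ j) *s axis j 1) = 1" by simp
  then show ?thesis using that by blast
qed

text \<open>If a vanished on all the vectors b_j e_i - b_i e_j of ker b, it would be a multiple of b.\<close>
lemma exists_dot_separating:
  fixes a b :: "'k::field^'n"
  assumes "b \<noteq> 0" and "\<And>c. a \<noteq> c *s b"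
  obtains v where "dot b v = 0" and "dot a v = 1"
proof -
  obtain j where j: "b $ j \<noteq> 0" using assms(1) by (metis vec_eq_iff zero_index)
  define e where "e i = b $ j *s axis i 1 - b $ i *s axis j (1::'k)" for i
  have b_e: "dot b (e i) = 0" for i by (simp add: e_def)
  have "\<exists>i. dot a (e i) \<noteq> 0"
  proof (rule ccontr)
    assume "\<nexists>i. dot a (e i) \<noteq> 0"
    then have "b $ j * a $ i - b $ i * a $ j = 0" for i by (simp add: e_def)
    with j have "a $ i = (a $ j / b $ j) * b $ i" for i by (simp add: field_simps)
    then have "a = (a $ j / b $ j) *s b" unfolding vec_eq_iff vector_smult_component by blast
    with assms(2) show False by blast
  qed
  then obtain i where i: "dot a (e i) \<noteq> 0" by blast
  have "dot b (inverse (dot a (e i)) *s e i) = 0" "dot a (inverse (dot a (e i)) *s e i) = 1"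
    using b_e i by simp_all
  then show ?thesis using that by blast
qed

lemma rank_one_form:
  fixes X :: "'k::field^'n^'n"
  assumes "\<And>v. X *v v \<in> vec.span {w}" and "w \<noteq> 0"
  obtains a where "\<And>v. X *v v = dot a v *s w"
proof -
  obtain i where i: "w $ i \<noteq> 0" using assms(2) by (metis vec_eq_iff zero_index)
  define a :: "'k^'n" where "a = (\<chi> j. X $ i $ j / w $ i)"
  have "X *v v = dot a v *s w" for v
  proof -
    obtain c where c: "X *v v = c *s w" using assms(1)[of v] by (auto simp: vec.span_singleton)
    then have "c = (X *v v) $ i / w $ i" using i by simp
    also have "\<dots> = dot a v"
      by (simp add: dot_def a_def matrix_vector_mult_def sum_divide_distrib algebra_simps)
    finally show ?thesis using c by simp
  qed
  then show ?thesis using that by blast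
qed

subsection \<open>Modules with one-dimensional mM\<close>

lemma dim_mM_eq: "vec.dim (mM X Y) = CARD('n) - top_dim X Y"
  for X Y :: "'k::field^'n^'n"
  using vec.dim_subset[of "mM X Y" UNIV] by (simp add: top_dim_def vec_dim_card card_cart_basis)

lemma supported_at_origin_nilpotent:
  assumes "supported_at_origin X Y"
  obtains N where "\<And>v. ((\<lambda>u. X *v u) ^^ N) v = 0" and "\<And>v. ((\<lambda>u. Y *v u) ^^ N) v = 0"
proof -
  obtain N where N: "\<And>i j v. i + j = N \<Longrightarrow> mono_act X Y i j v = 0"
    using assms unfolding supported_at_origin_def by blast
  show ?thesis
  proof (rule that)
    show "((\<lambda>u. X *v u) ^^ N) v = 0" for v using N[of N 0 v] by (simp add: mono_act_def)
    show "((\<lambda>u. Y *v u) ^^ N) v = 0" for v using N[of 0 N v] by (simp add: mono_act_def)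
  qed
qed

lemma nilpotent_eigenvalue_zero:
  fixes X :: "'k::field^'n^'n"
  assumes "\<And>v. ((\<lambda>u. X *v u) ^^ N) v = 0" and "X *v w = c *s w" and "w \<noteq> 0"
  shows "c = 0"
proof -
  have "((\<lambda>u. X *v u) ^^ n) w = c ^ n *s w" for n
    by (induction n) (simp_all add: vec.scale assms(2))
  then have "c ^ N *s w = 0" using assms(1) by metis
  with assms(3) show ?thesis by simp
qed

lemma rank_one_module:
  fixes X Y :: "'k::field^'n^'n"
  assumes "supported_at_origin X Y" and "vec.dim (mM X Y) = 1"
  obtains w a b where "w \<noteq> 0" "a \<noteq> 0 \<or> b \<noteq> 0" "dot a w = 0" "dot b w = 0"
    "\<And>v. X *v v = dot a v *s w" "\<And>v. Y *v v = dot b v *s w"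
proof -
  obtain B where B: "B \<subseteq> mM X Y" "vec.independent B" "mM X Y \<subseteq> vec.span B" "card B = 1"
    using vec.basis_exists[of "mM X Y"] assms(2) by metis
  obtain w where "B = {w}" using B(4) card_1_singletonE by blast
  with B have w: "w \<noteq> 0" "w \<in> mM X Y" "mM X Y \<subseteq> vec.span {w}" by auto
  have "X *v v \<in> mM X Y" "Y *v v \<in> mM X Y" for v
    unfolding mM_def by (auto intro: vec.span_base)
  with w obtain a b where X: "\<And>v. X *v v = dot a v *s w" and Y: "\<And>v. Y *v v = dot b v *s w"
    by (metis subsetD rank_one_form)
  obtain N where "\<And>v. ((\<lambda>u. X *v u) ^^ N) v = 0" "\<And>v. ((\<lambda>u. Y *v u) ^^ N) v = 0"
    using supported_at_origin_nilpotent[OF assms(1)] by blast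
  then have "dot a w = 0" "dot b w = 0"
    using nilpotent_eigenvalue_zero X Y w(1) by metis+
  moreover have "a \<noteq> 0 \<or> b \<noteq> 0"
  proof (rule ccontr)
    assume "\<not> (a \<noteq> 0 \<or> b \<noteq> 0)"
    with X Y have "range (\<lambda>v. X *v v) \<union> range (\<lambda>v. Y *v v) = {0}" by auto
    then have "mM X Y = {0}" by (simp add: mM_def)
    with w show False by simp
  qed
  ultimately show ?thesis using that w(1) X Y by blast
qed

subsection \<open>The two normal forms\<close>

lemma kxy_iso_if_injective_intertwiner:
  fixes P :: "'k::field^'m^'n" and X Y :: "'k^'n^'n" and X' Y' :: "'k^'m^'m"
  assumes "CARD('m) = CARD('n)" and "\<And>v. P *v v = 0 \<Longrightarrow> v = 0"
    and "\<And>v. P *v (X' *v v) = X *v (P *v v)" and "\<And>v. P *v (Y' *v v) = Y *v (P *v v)"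
  shows "kxy_iso X Y X' Y'"
proof -
  have "inj ((*v) P)"
    using assms(2) vec.linear_inj_iff_eq_0[OF matrix_vector_mul_linear_gen] by blast
  then obtain f where f: "Vector_Spaces.linear (*s) (*s) f" "\<And>x. f (P *v x) = x" "\<And>x. P *v f x = x"
    using vec.linear_injective_isomorphism[OF matrix_vector_mul_linear_gen] assms(1)
    by (metis vec_dim_card)
  have "bij f" by (metis f(2,3) bij_betw_byWitness subset_UNIV)
  moreover have "f (X *v v) = X' *v f v" "f (Y *v v) = Y' *v f v" for v
    by (metis f(2,3) assms(3,4))+
  ultimately show ?thesis unfolding kxy_iso_def using f(1) by blast
qed

lemma vec_Plus_eq_0_iff:
  "(v :: 'a::zero^('m::finite + 'n::finite)) = 0 \<longleftrightarrow> (\<forall>i. v $ Inl i = 0) \<and> (\<forall>j. v $ Inr j = 0)"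
  by (metis sumE vec_eq_iff zero_index)

lemma dsum_mult_Inl: "(dsum A B *v v) $ Inl i = (A *v (\<chi> i. v $ Inl i)) $ i"
  by (simp add: matrix_vector_mult_def dsum_def sum_Plus_UNIV)

lemma dsum_mult_Inr: "(dsum A B *v v) $ Inr j = (B *v (\<chi> j. v $ Inr j)) $ j"
  by (simp add: matrix_vector_mult_def dsum_def sum_Plus_UNIV)

lemma dual_op_Am2_x_mult: "dual_op Am2_x *v v = (\<chi> i. if i = 1 then v $ 2 else 0)"
  by (simp add: vec_eq_iff matrix_vector_mult_def dual_op_def Am2_x_def transpose_def sum_3)

lemma dual_op_Am2_y_mult: "dual_op Am2_y *v v = (\<chi> i. if i = 1 then v $ 3 else 0)"
  by (simp add: vec_eq_iff matrix_vector_mult_def dual_op_def Am2_y_def transpose_def sum_3)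

lemma kxy_iso_k_plus_dual_Am2_basis:
  fixes X Y :: "'k::field^4^4"
  assumes w: "w \<noteq> 0" and X: "\<And>v. X *v v = dot a v *s w" and Y: "\<And>v. Y *v v = dot b v *s w"
    and "dot a w = 0" "dot b w = 0" "dot a z = 0" "dot b z = 0" and z_w: "z \<notin> vec.span {w}"
    and "dot a ua = 1" "dot b ua = 0" "dot a ub = 0" "dot b ub = 1"
  shows "kxy_iso X Y (dsum (0 :: 'k^1^1) (dual_op Am2_x)) (dsum (0 :: 'k^1^1) (dual_op Am2_y))"
proof (rule kxy_iso_if_injective_intertwiner)
  define P :: "'k^(1+3)^4" where "P = (\<chi> r c. (case c of Inl _ \<Rightarrow> z
    | Inr i \<Rightarrow> if i = 1 then w else if i = 2 then ua else ub) $ r)"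
  have P: "P *v v = v $ Inl 1 *s z + v $ Inr 1 *s w + v $ Inr 2 *s ua + v $ Inr 3 *s ub" for v
    by (simp add: P_def matrix_of_columns_mult sum_Plus_UNIV sum_3 add.assoc)
  show "CARD(1 + 3) = CARD(4)" by simp
  show "P *v (dsum 0 (dual_op Am2_x) *v v) = X *v (P *v v)" for v
    using assms by (simp add: P X dsum_mult_Inl dsum_mult_Inr dual_op_Am2_x_mult)
  show "P *v (dsum 0 (dual_op Am2_y) *v v) = Y *v (P *v v)" for v
    using assms by (simp add: P Y dsum_mult_Inl dsum_mult_Inr dual_op_Am2_y_mult)
  fix v :: "'k^(1+3)"
  assume "P *v v = 0"
  then have "dot a (P *v v) = 0" "dot b (P *v v) = 0" by simp_all
  then have ua_ub: "v $ Inr 2 = 0" "v $ Inr 3 = 0" using assms by (simp_all add: P)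
  with \<open>P *v v = 0\<close> have "v $ Inl 1 *s z = (- v $ Inr 1) *s w"
    by (simp add: P eq_neg_iff_add_eq_0)
  then have "v $ Inl 1 *s z \<in> vec.span {w}" by (metis rangeI vec.span_singleton)
  then have z: "v $ Inl 1 = 0" using z_w by (rule scale_in_span_imp_zero)
  with ua_ub \<open>P *v v = 0\<close> w have "v $ Inr 1 = 0" by (simp add: P)
  with z ua_ub show "v = 0"
    by (simp add: vec_Plus_eq_0_iff forall_3)
qed

lemma kxy_iso_k_plus_dual_Am2:
  fixes X Y :: "'k::field^4^4"
  assumes "w \<noteq> 0" "\<And>v. X *v v = dot a v *s w" "\<And>v. Y *v v = dot b v *s w"
    "dot a w = 0" "dot b w = 0"
    and independent: "b \<noteq> 0" "\<And>c. a \<noteq> c *s b"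
  shows "kxy_iso X Y (dsum (0 :: 'k^1^1) (dual_op Am2_x)) (dsum (0 :: 'k^1^1) (dual_op Am2_y))"
proof -
  have "a \<noteq> 0" using independent(2)[of 0] by simp
  moreover have "b \<noteq> c *s a" for c
  proof
    assume "b = c *s a"
    with independent(1) have "c \<noteq> 0" by auto
    with \<open>b = c *s a\<close> have "a = inverse c *s b" by simp
    with independent(2) show False by blast
  qed
  ultimately obtain ub where ub: "dot a ub = 0" "dot b ub = 1"
    using exists_dot_separating by blast
  obtain ua where ua: "dot b ua = 0" "dot a ua = 1"
    using exists_dot_separating independent by blast
  obtain v where "v \<notin> vec.span (insert ua (insert ub {w}))"
    by (rule exists_not_in_span[of "{ua, ub, w}"]) (auto simp: card_insert_if)
  define z where "z = v - dot a v *s ua - dot b v *s ub"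
  have "z \<notin> vec.span {w}"
    using \<open>v \<notin> _\<close> unfolding z_def vec.span_breakdown_eq by (metis diff_diff_eq)
  moreover have "dot a z = 0" "dot b z = 0" using ua ub by (simp_all add: z_def)
  ultimately show ?thesis
    using kxy_iso_k_plus_dual_Am2_basis[OF assms(1-5)] ua ub by blast
qed

text \<open>With (s, t) \<noteq> 0, the matrices lower_corner s and lower_corner t are the actions of x and y
  on A/(m^2, t x - s y) in a basis (1, l) with x = s l and y = t l.\<close>
definition lower_corner :: "'k::field \<Rightarrow> 'k^2^2" where
  "lower_corner s = (\<chi> i j. if i = 2 \<and> j = 1 then s else 0)"

lemma lower_corner_mult: "lower_corner s *v v = (\<chi> i. if i = 2 then s * v $ 1 else 0)"
  by (auto simp: lower_corner_def vec_eq_iff matrix_vector_mult_def sum_2 forall_2)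

lemma lower_corner_mult_lower_corner: "lower_corner s *v (lower_corner t *v v) = 0"
  by (simp add: lower_corner_mult vec_eq_iff forall_2)

lemma kxy_module_lower_corner: "kxy_module (lower_corner s) (lower_corner t)"
  by (simp add: kxy_module_def lower_corner_def vec_eq_iff matrix_matrix_mult_def sum_2 forall_2)

lemma supported_at_origin_lower_corner: "supported_at_origin (lower_corner s) (lower_corner t)"
  unfolding supported_at_origin_def
proof (intro exI[of _ 2] allI impI)
  fix i j :: nat and v :: "'a^2"
  assume "i + j = 2"
  then consider "i = 2" "j = 0" | "i = 1" "j = 1" | "i = 0" "j = 2" by linarith
  then show "mono_act (lower_corner s) (lower_corner t) i j v = 0"
    by cases (simp_all add: mono_act_def numeral_2_eq_2 lower_corner_mult_lower_corner)
qed

lemma cyclic_module_lower_corner: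
  assumes "s \<noteq> 0 \<or> t \<noteq> 0"
  shows "cyclic_module (lower_corner s) (lower_corner (t :: 'k::field))"
proof -
  let ?e1 = "axis 1 1 :: 'k^2" and ?e2 = "axis 2 1 :: 'k^2"
  let ?S = "vec.span {mono_act (lower_corner s) (lower_corner t) i j ?e1 | i j. True}"
  have mono_act_in: "mono_act (lower_corner s) (lower_corner t) i j ?e1 \<in> ?S" for i j
    by (auto intro: vec.span_base)
  have "mono_act (lower_corner s) (lower_corner t) 0 0 ?e1 = ?e1"
    "mono_act (lower_corner s) (lower_corner t) 1 0 ?e1 = s *s ?e2"
    "mono_act (lower_corner s) (lower_corner t) 0 1 ?e1 = t *s ?e2"
    by (simp_all add: mono_act_def lower_corner_mult vec_eq_iff forall_2 axis_def)
  then have e1: "?e1 \<in> ?S" and "s *s ?e2 \<in> ?S" "t *s ?e2 \<in> ?S"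
    using mono_act_in[of 0 0] mono_act_in[of 1 0] mono_act_in[of 0 1] by simp_all
  then have "inverse s *s (s *s ?e2) \<in> ?S" "inverse t *s (t *s ?e2) \<in> ?S"
    by (simp_all only: vec.span_scale)
  then have e2: "?e2 \<in> ?S"
    using assms by (cases "s = 0") (simp_all add: vector_smult_assoc)
  have "x \<in> ?S" for x
  proof -
    have "x $ 1 *s ?e1 + x $ 2 *s ?e2 \<in> ?S" by (intro vec.span_add vec.span_scale e1 e2)
    moreover have "x $ 1 *s ?e1 + x $ 2 *s ?e2 = x" by (simp add: vec_eq_iff forall_2 axis_def)
    ultimately show ?thesis by simp
  qed
  then show ?thesis unfolding cyclic_module_def by blast
qed

lemma kxy_iso_k2_plus_lower_corner_basis:
  fixes X Y :: "'k::field^4^4"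
  assumes w: "w \<noteq> 0" and X: "\<And>v. X *v v = (s * dot g v) *s w" and Y: "\<And>v. Y *v v = (t * dot g v) *s w"
    and "dot g w = 0" "dot g u = 1" "dot g p = 0" "dot g q = 0"
    and p_w: "p \<notin> vec.span {w}" and q_pw: "q \<notin> vec.span {p, w}"
  shows "kxy_iso X Y (dsum (0 :: 'k^2^2) (lower_corner s)) (dsum (0 :: 'k^2^2) (lower_corner t))"
proof (rule kxy_iso_if_injective_intertwiner)
  define P :: "'k^(2+2)^4" where "P = (\<chi> r c. (case c of Inl i \<Rightarrow> if i = 1 then p else q
    | Inr i \<Rightarrow> if i = 1 then u else w) $ r)"
  have P: "P *v v = v $ Inl 1 *s p + v $ Inl 2 *s q + v $ Inr 1 *s u + v $ Inr 2 *s w" for v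
    by (simp add: P_def matrix_of_columns_mult sum_Plus_UNIV sum_2 add.assoc)
  show "CARD(2 + 2) = CARD(4)" by simp
  show "P *v (dsum 0 (lower_corner s) *v v) = X *v (P *v v)" for v
    using assms by (simp add: P X dsum_mult_Inl dsum_mult_Inr lower_corner_mult)
  show "P *v (dsum 0 (lower_corner t) *v v) = Y *v (P *v v)" for v
    using assms by (simp add: P Y dsum_mult_Inl dsum_mult_Inr lower_corner_mult)
  fix v :: "'k^(2+2)"
  assume "P *v v = 0"
  then have "dot g (P *v v) = 0" by simp
  then have u: "v $ Inr 1 = 0" using assms by (simp add: P)
  have "v $ Inl 2 *s q = - (v $ Inl 1 *s p + v $ Inr 2 *s w)"
    unfolding eq_neg_iff_add_eq_0 using \<open>P *v v = 0\<close> u by (simp add: P add_ac)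
  moreover have "- (v $ Inl 1 *s p + v $ Inr 2 *s w) \<in> vec.span {p, w}"
    by (intro vec.span_neg vec.span_add vec.span_scale vec.span_base) auto
  ultimately have "v $ Inl 2 *s q \<in> vec.span {p, w}" by (simp only:)
  then have q: "v $ Inl 2 = 0" using q_pw by (rule scale_in_span_imp_zero)
  with u \<open>P *v v = 0\<close> have "v $ Inl 1 *s p = (- v $ Inr 2) *s w"
    by (simp add: P eq_neg_iff_add_eq_0)
  then have "v $ Inl 1 *s p \<in> vec.span {w}" by (metis rangeI vec.span_singleton)
  then have p: "v $ Inl 1 = 0" using p_w by (rule scale_in_span_imp_zero)
  with u q \<open>P *v v = 0\<close> w have "v $ Inr 2 = 0" by (simp add: P)
  with u p q show "v = 0"
    by (simp add: vec_Plus_eq_0_iff forall_2)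
qed

lemma kxy_iso_k2_plus_lower_corner:
  fixes X Y :: "'k::field^4^4"
  assumes "w \<noteq> 0" "\<And>v. X *v v = (s * dot g v) *s w" "\<And>v. Y *v v = (t * dot g v) *s w"
    "dot g w = 0" "g \<noteq> 0"
  shows "kxy_iso X Y (dsum (0 :: 'k^2^2) (lower_corner s)) (dsum (0 :: 'k^2^2) (lower_corner t))"
proof -
  obtain u where u: "dot g u = 1" using exists_dot_eq_1 assms(5) by blast
  obtain v1 where "v1 \<notin> vec.span (insert u {w})"
    by (rule exists_not_in_span[of "{u, w}"]) (auto simp: card_insert_if)
  define p where "p = v1 - dot g v1 *s u"
  have p_w: "p \<notin> vec.span {w}"
    using \<open>v1 \<notin> _\<close> unfolding p_def vec.span_breakdown_eq by blast
  obtain v2 where "v2 \<notin> vec.span (insert u {p, w})"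
    by (rule exists_not_in_span[of "{u, p, w}"]) (auto simp: card_insert_if)
  define q where "q = v2 - dot g v2 *s u"
  have q_pw: "q \<notin> vec.span {p, w}"
    using \<open>v2 \<notin> _\<close> unfolding q_def vec.span_breakdown_eq by blast
  have "dot g p = 0" "dot g q = 0" using u by (simp_all add: p_def q_def)
  with kxy_iso_k2_plus_lower_corner_basis[OF assms(1-4) u] p_w q_pw show ?thesis by blast
qed

lemma proportional_if_not_independent:
  fixes a b :: "'k::field^'n"
  assumes "a \<noteq> 0 \<or> b \<noteq> 0" and "\<not> (b \<noteq> 0 \<and> (\<forall>c. a \<noteq> c *s b))"
  obtains g s t where "a = s *s g" "b = t *s g" "g \<noteq> 0" "s \<noteq> 0 \<or> t \<noteq> 0"
proof (cases "b = 0")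
  case True
  with assms(1) show ?thesis using that[of 1 a 0] by simp
next
  case False
  with assms(2) obtain c where "a = c *s b" by blast
  with False show ?thesis using that[of c b 1] by simp
qed

theorem proposition5p1:
  fixes X Y :: "'k::field_char_0 ^ 4 ^ 4"
  assumes "algebraically_closed_field TYPE('k)"
    and "kxy_module X Y"
    and "supported_at_origin X Y"
    and "top_dim X Y = 3"
  shows "kxy_iso X Y (dsum (0 :: 'k^1^1) (dual_op Am2_x)) (dsum (0 :: 'k^1^1) (dual_op Am2_y))
       \<or> (\<exists>XZ YZ :: 'k^2^2. kxy_module XZ YZ \<and> supported_at_origin XZ YZ \<and> cyclic_module XZ YZ \<and>
            kxy_iso X Y (dsum (0 :: 'k^2^2) XZ) (dsum (0 :: 'k^2^2) YZ))"
proof -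
  have "vec.dim (mM X Y) = 1" using assms(4) by (simp add: dim_mM_eq)
  then obtain w a b where w: "w \<noteq> 0" and ab: "a \<noteq> 0 \<or> b \<noteq> 0" and aw: "dot a w = 0" "dot b w = 0"
    and X: "\<And>v. X *v v = dot a v *s w" and Y: "\<And>v. Y *v v = dot b v *s w"
    using rank_one_module[OF assms(3)] by blast
  show ?thesis
  proof (cases "b \<noteq> 0 \<and> (\<forall>c. a \<noteq> c *s b)")
    case True
    with kxy_iso_k_plus_dual_Am2[OF w X Y aw] show ?thesis by blast
  next
    case False
    with ab obtain g s t where g: "a = s *s g" "b = t *s g" "g \<noteq> 0" and st: "s \<noteq> 0 \<or> t \<noteq> 0"
      by (rule proportional_if_not_independent)
    with aw have "dot g w = 0" by auto
    with kxy_iso_k2_plus_lower_corner[OF w _ _ _ \<open>g \<noteq> 0\<close>, of X s Y t] X Y g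
    have "kxy_iso X Y (dsum (0 :: 'k^2^2) (lower_corner s)) (dsum 0 (lower_corner t))" by simp
    with kxy_module_lower_corner supported_at_origin_lower_corner cyclic_module_lower_corner[OF st]
    show ?thesis by blast
  qed
qed

end
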